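(* (a) Let $H$ be a real Hilbert space and let $\Phi:H\to\mathbb{R}$ be a convex neural functional (CNF). Then $\Phi$ is convex and Lipschitz. (b) Moreover, let $L_0>0$, let $H$ be a nonzero separable real Hilbert space, let $C\subseteq H$ be compact and convex with $\operatorname{diam}(C)>0$, let $\rho:C\to\mathbb{R}$ be convex and $L_0$-Lipschitz, let $\{(\xi_n,y_n)\}_{n=1}^N\subseteq C\times\mathbb{R}$ with $y_n=\rho(\xi_n)$, and let $\varepsilon>0$. Let $M\in\mathbb{N}_+$, $\{p_m\}_{m=1}^M\subseteq\overline{B}_H(0,L_0)$, let $\Phi_M:\mathbb{R}^M\to\mathbb{R}$ be a convex $\operatorname{ReLU}$-MLP and $\Psi_N:\mathbb{R}^N\to\mathbb{R}$ a concave $\operatorname{ReLU}$-MLP such that the function $$f(x):=\Phi_M\Big(\bigoplus_{m=1}^M\Big[\langle p_m,x\rangle+\Psi_N\Big(\bigoplus_{n=1}^N\bigl(y_n-\langle p_m,\xi_n\rangle\bigr)\Big)\Big]\Big),\qquad x\in H,$$ satisfies $\max_{1\le n\le N}|\rho(\xi_n)-f(\xi_n)|<\varepsilon$. Then $f$ is exactly computable by some CNF, i.e. there is a CNF $\Phi:H\to\mathbb{R}$ with $\Phi(x)=f(x)$ for all $x\in H$.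
   Context: $\mathbb{N}_+=\{1,2,\dots\}$; $[r]_+=\{1,\dots,r\}$; $\overline{B}_H(0,r)$ is the closed ball of radius $r$; $\bigoplus_{m=1}^M z_m=(z_1,\dots,z_M)$ denotes concatenation of scalars. "$L_0$-Lipschitz" means Lipschitz with constant at most $L_0$. $\operatorname{ReLU}(t)=\max\{t,0\}$. A $\operatorname{ReLU}$-MLP is a map $\mathbb{R}^{d_0}\to\mathbb{R}^{d_J}$, with $J,d_0,\dots,d_J\in\mathbb{N}_+$, of the form $x\mapsto A^{(J-1)}x^{(J-1)}+b^{(J-1)}$, where $x^{(0)}=x$ and $x^{(j+1)}=\operatorname{ReLU}^{\bullet}(A^{(j)}x^{(j)}+b^{(j)})$ for $j=0,\dots,J-2$, with $A^{(j)}\in\mathbb{R}^{d_{j+1}\times d_j}$, $b^{(j)}\in\mathbb{R}^{d_{j+1}}$ and $\operatorname{ReLU}^{\bullet}$ componentwise. It is called convex (concave) if it is convex (concave) as a function. For $n\in\mathbb{N}_+$ and $\alpha\in[0,1]^n$, $\operatorname{PReLU}^{\bullet}_{\alpha}:\mathbb{R}^n\to\mathbb{R}^n$ is $\operatorname{PReLU}^{\bullet}_{\alpha}(u)=\bigl(\operatorname{ReLU}(u_i)-\alpha_i\operatorname{ReLU}(-u_i)\bigr)_{i=1}^n$. Convex neural functional (CNF): let $H$ be a real Hilbert space, $d,M,L\in\mathbb{N}_+$ with $L\ge2$ and $\dim(H)\ge d$, $V\subseteq H$ a $d$-dimensional linear subspace, $p_1,\dots,p_M\in V$, $q_1,\dots,q_M\in\mathbb{R}$.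 Let $d_0,\dots,d_L\in\mathbb{N}_+$ and $d_1',\dots,d_{L-1}'\in\mathbb{N}_+$ with $d_0=M$, $d_L=1$, and $d_\ell'\ge d_\ell$ for $\ell=1,\dots,L-1$. A map $\Phi:H\to\mathbb{R}$ is a CNF if, for some such data, it has the form $$\Phi(x)=A^{(L-1)}x^{(L-1)}+b^{(L-1)},\qquad x^{(\ell+1)}=\max_{\Pi^{(\ell)}}\operatorname{PReLU}^{\bullet}_{\alpha^{(\ell)}}\bigl(A^{(\ell)}x^{(\ell)}+b^{(\ell)}\bigr)\ \ (\ell=0,\dots,L-2),\qquad x^{(0)}=\bigoplus_{m=1}^M\bigl[\langle p_m,x\rangle_H+q_m\bigr],$$ where $A^{(\ell)}\in[0,\infty)^{d_{\ell+1}'\times d_\ell}$, $b^{(\ell)}\in\mathbb{R}^{d_{\ell+1}'}$, $\alpha^{(\ell)}\in[0,1]^{d_{\ell+1}'}$ for $\ell=0,\dots,L-2$, $A^{(L-1)}\in[0,\infty)^{1\times d_{L-1}}$, $b^{(L-1)}\in\mathbb{R}$, and for each $\ell=0,\dots,L-2$, $\Pi^{(\ell)}=\{[[k]]_{\Pi^{(\ell)}}\}_{k=1}^{d_{\ell+1}}$ is a partition of $[d_{\ell+1}']_+$ into $d_{\ell+1}$ non-empty parts, with max-pooling map $\max_{\Pi^{(\ell)}}:\mathbb{R}^{d_{\ell+1}'}\to\mathbb{R}^{d_{\ell+1}}$, $\max_{\Pi^{(\ell)}}(z)_k=\max_{i\in[[k]]_{\Pi^{(\ell)}}}z_i$. 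*)

theory Defs
  imports
    "HOL-Analysis.Analysis"
    "HOL-Library.Disjoint_Sets"
    "Jordan_Normal_Form.Matrix"
begin

hide_type (open) Finite_Cartesian_Product.vec
hide_const (open) Finite_Cartesian_Product.vec Finite_Cartesian_Product.vec_nth
no_notation Finite_Cartesian_Product.vec_nth (infixl "$" 90)

text \<open>
  The dimensions of the layers of a network are existentially quantified, so \<open>\<real>\<^sup>n\<close> is represented
  by \<^term>\<open>carrier_vec n :: real vec set\<close>, and only the values of a function on this set matter.
  Components, layers' units and families are indexed from \<open>0\<close>: the index set \<open>{1, \<dots>, n}\<close> becomes
  \<^term>\<open>{..<n::nat}\<close>. Layer indices start at \<open>0\<close> in any case.

  A real Hilbert space is a type of sort \<open>{real_inner, complete_space}\<close>.
\<close>

definition convex_on_carrier :: "nat \<Rightarrow> (real vec \<Rightarrow> real) \<Rightarrow> bool" where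
  "convex_on_carrier n F \<longleftrightarrow>
     (\<forall>x\<in>carrier_vec n. \<forall>y\<in>carrier_vec n. \<forall>u\<ge>0. \<forall>v\<ge>0. u + v = 1 \<longrightarrow>
        F (u \<cdot>\<^sub>v x + v \<cdot>\<^sub>v y) \<le> u * F x + v * F y)"

definition concave_on_carrier :: "nat \<Rightarrow> (real vec \<Rightarrow> real) \<Rightarrow> bool" where
  "concave_on_carrier n F \<longleftrightarrow> convex_on_carrier n (\<lambda>x. - F x)"

definition relu :: "real \<Rightarrow> real" where
  "relu t = max t 0"

primrec mlp_layer :: "(nat \<Rightarrow> real mat) \<Rightarrow> (nat \<Rightarrow> real vec) \<Rightarrow> real vec \<Rightarrow> nat \<Rightarrow> real vec" where
  "mlp_layer A b x 0 = x"
| "mlp_layer A b x (Suc j) = map_vec relu (A j *\<^sub>v mlp_layer A b x j + b j)"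

definition is_relu_mlp :: "nat \<Rightarrow> nat \<Rightarrow> (real vec \<Rightarrow> real vec) \<Rightarrow> bool" where
  "is_relu_mlp m n F \<longleftrightarrow>
     (\<exists>(J::nat) (d :: nat \<Rightarrow> nat) A b.
        1 \<le> J \<and> (\<forall>j\<le>J. 1 \<le> d j) \<and> d 0 = m \<and> d J = n \<and>
        (\<forall>j<J. A j \<in> carrier_mat (d (Suc j)) (d j) \<and> b j \<in> carrier_vec (d (Suc j))) \<and>
        (\<forall>x\<in>carrier_vec m. F x = A (J - 1) *\<^sub>v mlp_layer A b x (J - 1) + b (J - 1)))"

text \<open>Maps into \<open>\<real>\<close>, identified with \<open>\<real>\<^sup>1\<close>.\<close>

definition is_real_relu_mlp :: "nat \<Rightarrow> (real vec \<Rightarrow> real) \<Rightarrow> bool" where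
  "is_real_relu_mlp m F \<longleftrightarrow> is_relu_mlp m 1 (\<lambda>x. Matrix.vec 1 (\<lambda>_. F x))"

definition prelu :: "real vec \<Rightarrow> real vec \<Rightarrow> real vec" where
  "prelu \<alpha> u = Matrix.vec (dim_vec u) (\<lambda>i. relu (u $ i) - \<alpha> $ i * relu (- (u $ i)))"

text \<open>
  A partition of \<open>{..<m}\<close> into \<open>n\<close> non-empty parts comes with an enumeration \<open>P 0, \<dots>, P (n - 1)\<close>
  of its parts, which fixes the order of the components of the pooled vector.
\<close>

definition is_indexed_partition :: "nat \<Rightarrow> nat \<Rightarrow> (nat \<Rightarrow> nat set) \<Rightarrow> bool" where
  "is_indexed_partition m n P \<longleftrightarrow> inj_on P {..<n} \<and> partition_on {..<m} (P ` {..<n})"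

definition max_pool :: "nat \<Rightarrow> (nat \<Rightarrow> nat set) \<Rightarrow> real vec \<Rightarrow> real vec" where
  "max_pool n P z = Matrix.vec n (\<lambda>k. Max ((\<lambda>i. z $ i) ` P k))"

primrec cnf_layer ::
  "(nat \<Rightarrow> nat) \<Rightarrow> (nat \<Rightarrow> nat \<Rightarrow> nat set) \<Rightarrow> (nat \<Rightarrow> real vec) \<Rightarrow> (nat \<Rightarrow> real mat) \<Rightarrow> (nat \<Rightarrow> real vec) \<Rightarrow>
   real vec \<Rightarrow> nat \<Rightarrow> real vec" where
  "cnf_layer d P \<alpha> A b x 0 = x"
| "cnf_layer d P \<alpha> A b x (Suc l) =
     max_pool (d (Suc l)) (P l) (prelu (\<alpha> l) (A l *\<^sub>v cnf_layer d P \<alpha> A b x l + b l))"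

text \<open>
  In \<open>is_cnf\<close>, \<open>D\<close> is the dimension of the subspace \<open>V\<close>; \<open>d l\<close> and \<open>d' l\<close> are the widths of layer \<open>l\<close>
  after and before pooling. As \<^const>\<open>dim\<close> is \<open>0\<close> on infinite-dimensional spaces, \<open>dim H \<ge> D\<close> is
  expressed by \<open>D\<close> linearly independent vectors, and \<open>dim V = D \<ge> 1\<close> forces \<open>V\<close> to be
  finite-dimensional.
\<close>

definition is_cnf :: "('h::{real_inner,complete_space} \<Rightarrow> real) \<Rightarrow> bool" where
  "is_cnf \<Phi> \<longleftrightarrow>
     (\<exists>(D::nat) (M::nat) (L::nat) (V :: 'h set) (p :: nat \<Rightarrow> 'h) (q :: nat \<Rightarrow> real)
        (d :: nat \<Rightarrow> nat) (d' :: nat \<Rightarrow> nat) (A :: nat \<Rightarrow> real mat) (b :: nat \<Rightarrow> real vec)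
        (\<alpha> :: nat \<Rightarrow> real vec) (P :: nat \<Rightarrow> nat \<Rightarrow> nat set).
        1 \<le> D \<and> 1 \<le> M \<and> 2 \<le> L \<and>
        (\<exists>B :: 'h set. finite B \<and> independent B \<and> card B = D) \<and>
        subspace V \<and> dim V = D \<and> (\<forall>m<M. p m \<in> V) \<and>
        (\<forall>l\<le>L. 1 \<le> d l) \<and> d 0 = M \<and> d L = 1 \<and>
        (\<forall>l\<in>{1..L-1}. 1 \<le> d' l \<and> d l \<le> d' l) \<and>
        (\<forall>l<L-1.
           A l \<in> carrier_mat (d' (Suc l)) (d l) \<and> elements_mat (A l) \<subseteq> {0..} \<and>
           b l \<in> carrier_vec (d' (Suc l)) \<and>
           \<alpha> l \<in> carrier_vec (d' (Suc l)) \<and> set\<^sub>v (\<alpha> l) \<subseteq> {0..1} \<and>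
           is_indexed_partition (d' (Suc l)) (d (Suc l)) (P l)) \<and>
        A (L-1) \<in> carrier_mat 1 (d (L-1)) \<and> elements_mat (A (L-1)) \<subseteq> {0..} \<and>
        b (L-1) \<in> carrier_vec 1 \<and>
        (\<forall>x. \<Phi> x =
           (A (L-1) *\<^sub>v cnf_layer d P \<alpha> A b (Matrix.vec M (\<lambda>m. inner (p m) x + q m)) (L-1) + b (L-1)) $ 0))"

end

theory Submission
  imports Defs
begin

text \<open>
  Part (a) holds because being convex and Lipschitz is preserved by everything a layer does:
  sums, nonnegative multiples, constants and maxima. The PReLU with slope \<open>a \<in> [0, 1]\<close> belongs to
  this list, since it equals \<open>t \<mapsto> max t (a * t)\<close>. An induction over the layers
  (\<open>cnf_layer_convex_lipschitz\<close>) then gives the claim.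

  For part (b), observe that \<open>\<Psi>\<^sub>N\<close> contributes only constants, so that \<open>f\<close> is \<open>\<Phi>\<^sub>M\<close> composed with an
  affine map \<open>H \<rightarrow> \<real>\<^sup>M\<close>. Hence \<open>f\<close> is convex, and by induction over the layers of \<open>\<Phi>\<^sub>M\<close> it is
  continuous and agrees at every point with one of finitely many continuous affine functions
  (\<open>mlp_layer_piecewise_affine\<close>). Such a function is a maximum of affine functions
  (\<open>convex_piecewise_affine_eq_Max\<close>). Indeed, if it coincides with an affine piece on a
  nonempty open set, then by convexity that piece is a global minorant. The sets on which it
  coincides with one of the other pieces are closed with empty interior, and so is their finite
  union; therefore the minorants that come from open sets attain \<open>f\<close> on a dense set, which is
  closed, hence everywhere. Finally, a maximum of affine functions on \<open>H\<close> is a CNF with a single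
  hidden layer (\<open>is_cnf_Max_affine\<close>). The argument takes place in \<open>H\<close>
  itself, so no topology on \<open>\<real>\<^sup>M\<close> is involved.
\<close>

section \<open>Components of an affine layer\<close>

lemma affine_layer_index:
  fixes A :: "real mat"
  assumes "A \<in> carrier_mat m n" "b \<in> carrier_vec m" "z \<in> carrier_vec n" "i < m"
  shows "(A *\<^sub>v z + b) $ i = (\<Sum>j<n. A $$ (i, j) * z $ j) + b $ i"
  using assms by (auto simp: scalar_prod_def lessThan_atLeast0 intro!: sum.cong)

section \<open>Convex Lipschitz functions\<close>

definition convex_lipschitz :: "('h::real_inner \<Rightarrow> real) \<Rightarrow> bool" where
  "convex_lipschitz f \<longleftrightarrow> convex_on UNIV f \<and> (\<exists>K. K-lipschitz_on UNIV f)"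

lemma convex_lipschitz_inner: "convex_lipschitz (\<lambda>x. inner p x + c)"
  unfolding convex_lipschitz_def
proof (intro conjI exI)
  show "convex_on UNIV (\<lambda>x. inner p x + c)"
    by (rule convex_onI) (auto simp: inner_add_right algebra_simps)
  show "(norm p)-lipschitz_on UNIV (\<lambda>x. inner p x + c)"
    by (rule lipschitz_onI)
      (auto simp: dist_norm inner_diff_right[symmetric] Cauchy_Schwarz_ineq2)
qed

lemma convex_lipschitz_const: "convex_lipschitz (\<lambda>x. c)"
  using convex_lipschitz_inner[of 0 c] by simp

lemma convex_lipschitz_add:
  assumes "convex_lipschitz f" "convex_lipschitz g"
  shows "convex_lipschitz (\<lambda>x. f x + g x)"
  using assms unfolding convex_lipschitz_def
  by (auto intro!: convex_on_add lipschitz_on_add)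

lemma convex_lipschitz_scale:
  assumes "convex_lipschitz f" "0 \<le> (a::real)"
  shows "convex_lipschitz (\<lambda>x. a * f x)"
proof -
  from assms obtain K where "convex_on UNIV f" "K-lipschitz_on UNIV f"
    unfolding convex_lipschitz_def by auto
  then have "convex_on UNIV (\<lambda>x. a * f x)" "(\<bar>a\<bar> * K)-lipschitz_on UNIV (\<lambda>x. a * f x)"
    using assms(2) lipschitz_on_cmult_real[of K UNIV f a] by (auto intro: convex_on_cmul)
  then show ?thesis unfolding convex_lipschitz_def by blast
qed

lemma convex_lipschitz_max:
  assumes "convex_lipschitz f" "convex_lipschitz g"
  shows "convex_lipschitz (\<lambda>x. max (f x) (g x))"
proof -
  from assms obtain K L where f: "convex_on UNIV f" "K-lipschitz_on UNIV f"
    and g: "convex_on UNIV g" "L-lipschitz_on UNIV g"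
    unfolding convex_lipschitz_def by auto
  have "convex_on UNIV (\<lambda>x. max (f x) (g x))"
  proof (rule convex_onI)
    fix t x y assume t: "0 < (t::real)" "t < 1"
    have "f ((1 - t) *\<^sub>R x + t *\<^sub>R y) \<le> (1 - t) * f x + t * f y"
      "g ((1 - t) *\<^sub>R x + t *\<^sub>R y) \<le> (1 - t) * g x + t * g y"
      using convex_onD[OF f(1), of t x y] convex_onD[OF g(1), of t x y] t by auto
    moreover have "(1 - t) * f x \<le> (1 - t) * max (f x) (g x)" "t * f y \<le> t * max (f y) (g y)"
      "(1 - t) * g x \<le> (1 - t) * max (f x) (g x)" "t * g y \<le> t * max (f y) (g y)"
      using t by (auto intro!: mult_left_mono)
    ultimately show "max (f ((1 - t) *\<^sub>R x + t *\<^sub>R y)) (g ((1 - t) *\<^sub>R x + t *\<^sub>R y))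
      \<le> (1 - t) * max (f x) (g x) + t * max (f y) (g y)" by linarith
  qed simp
  moreover have "(max K L)-lipschitz_on UNIV (\<lambda>x. max (f x) (g x))"
  proof (rule lipschitz_onI)
    fix x y
    have "\<bar>f x - f y\<bar> \<le> K * dist x y" "\<bar>g x - g y\<bar> \<le> L * dist x y"
      using lipschitz_onD[OF f(2), of x y] lipschitz_onD[OF g(2), of x y]
      by (auto simp: dist_real_def)
    moreover have "K * dist x y \<le> max K L * dist x y" "L * dist x y \<le> max K L * dist x y"
      by (auto intro!: mult_right_mono)
    ultimately show "dist (max (f x) (g x)) (max (f y) (g y)) \<le> max K L * dist x y"
      unfolding dist_real_def by linarith
  next
    show "0 \<le> max K L" using lipschitz_on_nonneg[OF f(2)] by linarith
  qed
  ultimately show ?thesis unfolding convex_lipschitz_def by blast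
qed

lemma convex_lipschitz_sum:
  assumes "finite I" "\<And>i. i \<in> I \<Longrightarrow> convex_lipschitz (F i)"
  shows "convex_lipschitz (\<lambda>x. \<Sum>i\<in>I. F i x)"
  using assms
  by (induction rule: finite_induct) (auto intro: convex_lipschitz_const convex_lipschitz_add)

lemma convex_lipschitz_Max:
  assumes "finite I" "I \<noteq> {}" "\<And>i. i \<in> I \<Longrightarrow> convex_lipschitz (F i)"
  shows "convex_lipschitz (\<lambda>x. Max ((\<lambda>i. F i x) ` I))"
  using assms
  by (induction rule: finite_ne_induct) (auto intro: convex_lipschitz_max)

text \<open>
  The nonnegativity of the weights matters here, since negative multiples would destroy convexity.
\<close>

lemma convex_lipschitz_affine_layer:
  assumes A: "A \<in> carrier_mat m n" "elements_mat A \<subseteq> {0..}" and b: "b \<in> carrier_vec m"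
    and z: "\<And>x. z x \<in> carrier_vec n" "\<And>j. j < n \<Longrightarrow> convex_lipschitz (\<lambda>x. z x $ j)"
    and i: "i < m"
  shows "convex_lipschitz (\<lambda>x. (A *\<^sub>v z x + b) $ i)"
proof -
  have "0 \<le> A $$ (i, j)" if "j < n" for j
    using A i that elements_matI[OF A(1) i that refl] by auto
  then show ?thesis
    unfolding affine_layer_index[OF A(1) b z(1) i]
    by (intro convex_lipschitz_add convex_lipschitz_sum convex_lipschitz_scale
        convex_lipschitz_const) (auto intro: z)
qed

lemma prelu_index:
  assumes "i < dim_vec u" "\<alpha> $ i \<le> 1"
  shows "prelu \<alpha> u $ i = max (u $ i) (\<alpha> $ i * u $ i)"
proof -
  have "\<alpha> $ i * u $ i \<le> u $ i" if "0 \<le> u $ i"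
    using mult_right_mono[OF assms(2) that] by simp
  moreover have "u $ i \<le> \<alpha> $ i * u $ i" if "u $ i \<le> 0"
    using mult_right_mono_neg[OF assms(2) that] by simp
  ultimately show ?thesis
    using assms(1) by (auto simp: prelu_def relu_def max_def)
qed

lemma indexed_partition_parts:
  assumes "is_indexed_partition m n P" "k < n"
  shows "P k \<noteq> {}" "P k \<subseteq> {..<m}" "finite (P k)"
proof -
  have "partition_on {..<m} (P ` {..<n})" using assms by (simp add: is_indexed_partition_def)
  then show "P k \<noteq> {}" "P k \<subseteq> {..<m}"
    using assms(2) by (auto simp: partition_on_def)
  then show "finite (P k)" using finite_subset by blast
qed

lemma cnf_layer_convex_lipschitz:
  assumes z: "\<And>x. z x \<in> carrier_vec (d 0)" "\<And>i. i < d 0 \<Longrightarrow> convex_lipschitz (\<lambda>x. z x $ i)"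
    and layers: "\<forall>l<n. A l \<in> carrier_mat (d' (Suc l)) (d l) \<and> elements_mat (A l) \<subseteq> {0..} \<and>
           b l \<in> carrier_vec (d' (Suc l)) \<and>
           \<alpha> l \<in> carrier_vec (d' (Suc l)) \<and> set\<^sub>v (\<alpha> l) \<subseteq> {0..1} \<and>
           is_indexed_partition (d' (Suc l)) (d (Suc l)) (P l)"
    and "l \<le> n"
  shows "(\<forall>x. cnf_layer d P \<alpha> A b (z x) l \<in> carrier_vec (d l)) \<and>
    (\<forall>i<d l. convex_lipschitz (\<lambda>x. cnf_layer d P \<alpha> A b (z x) l $ i))"
  using \<open>l \<le> n\<close>
proof (induction l)
  case 0
  then show ?case using z by simp
next
  case (Suc l)
  define y where "y x = cnf_layer d P \<alpha> A b (z x) l" for x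
  define u where "u x = A l *\<^sub>v y x + b l" for x
  have y: "\<And>x. y x \<in> carrier_vec (d l)" "\<And>i. i < d l \<Longrightarrow> convex_lipschitz (\<lambda>x. y x $ i)"
    using Suc by (auto simp: y_def)
  from layers Suc.prems have A: "A l \<in> carrier_mat (d' (Suc l)) (d l)" "elements_mat (A l) \<subseteq> {0..}"
    and b: "b l \<in> carrier_vec (d' (Suc l))"
    and \<alpha>: "\<alpha> l \<in> carrier_vec (d' (Suc l))" "set\<^sub>v (\<alpha> l) \<subseteq> {0..1}"
    and P: "is_indexed_partition (d' (Suc l)) (d (Suc l)) (P l)"
    by auto
  have dim_u: "dim_vec (u x) = d' (Suc l)" for x using b by (simp add: u_def)
  have prelu: "convex_lipschitz (\<lambda>x. prelu (\<alpha> l) (u x) $ i)" if i: "i < d' (Suc l)" for i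
  proof -
    have "\<alpha> l $ i \<in> set\<^sub>v (\<alpha> l)" using \<alpha>(1) i by (intro vec_setI) auto
    then have \<alpha>i: "0 \<le> \<alpha> l $ i" "\<alpha> l $ i \<le> 1" using \<alpha>(2) by auto
    have "convex_lipschitz (\<lambda>x. u x $ i)"
      unfolding u_def by (rule convex_lipschitz_affine_layer[OF A b y i])
    then show ?thesis
      using i dim_u \<alpha>i(2)
      by (simp add: prelu_index convex_lipschitz_max convex_lipschitz_scale \<alpha>i(1))
  qed
  have "convex_lipschitz (\<lambda>x. Max ((\<lambda>i. prelu (\<alpha> l) (u x) $ i) ` P l k))" if "k < d (Suc l)" for k
    using indexed_partition_parts[OF P that] by (intro convex_lipschitz_Max prelu) auto
  then show ?case by (simp add: max_pool_def y_def[symmetric] u_def[symmetric])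
qed

lemma is_cnf_convex_lipschitz:
  assumes "is_cnf \<Phi>"
  shows "convex_lipschitz \<Phi>"
proof -
  from assms obtain M L p q d d' A b \<alpha> P where
    d: "d 0 = M" and
    layers: "\<forall>l<L-1. A l \<in> carrier_mat (d' (Suc l)) (d l) \<and> elements_mat (A l) \<subseteq> {0..} \<and>
           b l \<in> carrier_vec (d' (Suc l)) \<and>
           \<alpha> l \<in> carrier_vec (d' (Suc l)) \<and> set\<^sub>v (\<alpha> l) \<subseteq> {0..1} \<and>
           is_indexed_partition (d' (Suc l)) (d (Suc l)) (P l)" and
    last: "A (L-1) \<in> carrier_mat 1 (d (L-1))" "elements_mat (A (L-1)) \<subseteq> {0..}"
        "b (L-1) \<in> carrier_vec 1" and
    \<Phi>: "\<And>x. \<Phi> x = (A (L-1) *\<^sub>v cnf_layer d P \<alpha> A b (Matrix.vec M (\<lambda>m. inner (p m) x + q m)) (L-1)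
              + b (L-1)) $ 0"
    unfolding is_cnf_def by (elim exE conjE) blast
  define z where "z x = Matrix.vec M (\<lambda>m. inner (p m) x + q m)" for x
  have z: "\<And>x. z x \<in> carrier_vec (d 0)" "\<And>i. i < d 0 \<Longrightarrow> convex_lipschitz (\<lambda>x. z x $ i)"
    using d by (auto simp: z_def convex_lipschitz_inner)
  note hidden = cnf_layer_convex_lipschitz[OF z layers order.refl]
  have "convex_lipschitz (\<lambda>x. (A (L-1) *\<^sub>v cnf_layer d P \<alpha> A b (z x) (L-1) + b (L-1)) $ 0)"
    by (rule convex_lipschitz_affine_layer[OF last]) (use hidden in auto)
  then show ?thesis unfolding z_def \<Phi>[symmetric] .
qed

section \<open>Continuous piecewise affine functions\<close>

text \<open>
  A pair \<open>(v, c)\<close> stands for the affine function \<open>x \<mapsto> \<langle>v, x\<rangle> + c\<close>. Only a pointwise selection among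
  finitely many pieces is required, and not polyhedral regions on which one piece is selected:
  this is all that the maximum representation below uses, and it is trivially stable under the
  operations of a network.
\<close>

definition piecewise_affine :: "('h::real_inner \<Rightarrow> real) \<Rightarrow> bool" where
  "piecewise_affine f \<longleftrightarrow> continuous_on UNIV f \<and>
     (\<exists>S. finite S \<and> (\<forall>x. \<exists>(v, c)\<in>S. f x = inner v x + c))"

lemma piecewise_affine_inner: "piecewise_affine (\<lambda>x. inner v x + c)"
  unfolding piecewise_affine_def
  by (auto intro!: continuous_intros exI[of _ "{(v, c)}"])

lemma piecewise_affine_const: "piecewise_affine (\<lambda>x. c)"
  using piecewise_affine_inner[of 0 c] by simp

lemma piecewise_affine_add:
  assumes "piecewise_affine f" "piecewise_affine g"
  shows "piecewise_affine (\<lambda>x. f x + g x)"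
proof -
  from assms obtain S T where fg: "continuous_on UNIV f" "continuous_on UNIV g"
    and S: "finite S" "\<And>x. \<exists>(v, c)\<in>S. f x = inner v x + c"
    and T: "finite T" "\<And>x. \<exists>(v, c)\<in>T. g x = inner v x + c"
    unfolding piecewise_affine_def by auto
  let ?U = "(\<lambda>(s, t). (fst s + fst t, snd s + snd t)) ` (S \<times> T)"
  have "\<exists>(v, c)\<in>?U. f x + g x = inner v x + c" for x
  proof -
    from S(2)[of x] T(2)[of x] obtain s t where
      st: "s \<in> S" "f x = inner (fst s) x + snd s" "t \<in> T" "g x = inner (fst t) x + snd t"
      by auto
    have "(fst s + fst t, snd s + snd t) \<in> ?U" using st by (auto intro!: image_eqI[of _ _ "(s, t)"])
    then show ?thesis by (rule rev_bexI) (use st in \<open>simp add: inner_add_left\<close>)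
  qed
  moreover have "finite ?U" using S T by simp
  ultimately show ?thesis
    unfolding piecewise_affine_def using fg by (blast intro: continuous_on_add)
qed

lemma piecewise_affine_scale:
  assumes "piecewise_affine f"
  shows "piecewise_affine (\<lambda>x. a * f x)"
proof -
  from assms obtain S where f: "continuous_on UNIV f"
    and S: "finite S" "\<And>x. \<exists>(v, c)\<in>S. f x = inner v x + c"
    unfolding piecewise_affine_def by auto
  let ?U = "(\<lambda>(v, c). (a *\<^sub>R v, a * c)) ` S"
  have "\<exists>(v, c)\<in>?U. a * f x = inner v x + c" for x
  proof -
    from S(2)[of x] obtain v c where vc: "(v, c) \<in> S" "f x = inner v x + c" by auto
    have "(a *\<^sub>R v, a * c) \<in> ?U" using vc by (auto intro!: image_eqI[of _ _ "(v, c)"])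
    then show ?thesis by (rule rev_bexI) (use vc in \<open>simp add: algebra_simps\<close>)
  qed
  moreover have "finite ?U" using S by simp
  moreover have "continuous_on UNIV (\<lambda>x. a * f x)" by (intro continuous_intros f)
  ultimately show ?thesis
    unfolding piecewise_affine_def by blast
qed

lemma piecewise_affine_max:
  assumes "piecewise_affine f" "piecewise_affine g"
  shows "piecewise_affine (\<lambda>x. max (f x) (g x))"
proof -
  from assms obtain S T where fg: "continuous_on UNIV f" "continuous_on UNIV g"
    and S: "finite S" "\<And>x. \<exists>(v, c)\<in>S. f x = inner v x + c"
    and T: "finite T" "\<And>x. \<exists>(v, c)\<in>T. g x = inner v x + c"
    unfolding piecewise_affine_def by auto
  have "\<exists>(v, c)\<in>S \<union> T. max (f x) (g x) = inner v x + c" for x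
    using S(2)[of x] T(2)[of x] by (cases "f x \<le> g x") (auto simp: max_def)
  moreover have "finite (S \<union> T)" using S T by simp
  moreover have "continuous_on UNIV (\<lambda>x. max (f x) (g x))" by (intro continuous_intros fg)
  ultimately show ?thesis
    unfolding piecewise_affine_def by blast
qed

lemma piecewise_affine_sum:
  assumes "finite I" "\<And>i. i \<in> I \<Longrightarrow> piecewise_affine (F i)"
  shows "piecewise_affine (\<lambda>x. \<Sum>i\<in>I. F i x)"
  using assms
  by (induction rule: finite_induct) (auto intro: piecewise_affine_const piecewise_affine_add)

lemma piecewise_affine_affine_layer:
  assumes "A \<in> carrier_mat m n" "b \<in> carrier_vec m"
    and z: "\<And>x. z x \<in> carrier_vec n" "\<And>j. j < n \<Longrightarrow> piecewise_affine (\<lambda>x. z x $ j)"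
    and "i < m"
  shows "piecewise_affine (\<lambda>x. (A *\<^sub>v z x + b) $ i)"
  unfolding affine_layer_index[OF assms(1,2) z(1) assms(5)]
  by (intro piecewise_affine_add piecewise_affine_sum piecewise_affine_scale
      piecewise_affine_const) (auto intro: z)

lemma mlp_layer_piecewise_affine:
  assumes z: "\<And>x. z x \<in> carrier_vec (d 0)" "\<And>i. i < d 0 \<Longrightarrow> piecewise_affine (\<lambda>x. z x $ i)"
    and layers: "\<forall>j<n. A j \<in> carrier_mat (d (Suc j)) (d j) \<and> b j \<in> carrier_vec (d (Suc j))"
    and "j \<le> n"
  shows "(\<forall>x. mlp_layer A b (z x) j \<in> carrier_vec (d j)) \<and>
    (\<forall>i<d j. piecewise_affine (\<lambda>x. mlp_layer A b (z x) j $ i))"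
  using \<open>j \<le> n\<close>
proof (induction j)
  case 0
  then show ?case using z by simp
next
  case (Suc j)
  define y where "y x = mlp_layer A b (z x) j" for x
  have y: "\<And>x. y x \<in> carrier_vec (d j)" "\<And>i. i < d j \<Longrightarrow> piecewise_affine (\<lambda>x. y x $ i)"
    using Suc by (auto simp: y_def)
  from layers Suc.prems have A: "A j \<in> carrier_mat (d (Suc j)) (d j)"
    and b: "b j \<in> carrier_vec (d (Suc j))"
    by auto
  have "piecewise_affine (\<lambda>x. map_vec relu (A j *\<^sub>v y x + b j) $ i)" if i: "i < d (Suc j)" for i
  proof -
    have "piecewise_affine (\<lambda>x. max ((A j *\<^sub>v y x + b j) $ i) 0)"
      by (intro piecewise_affine_max piecewise_affine_const
          piecewise_affine_affine_layer[OF A b y i])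
    then show ?thesis using i A b by (simp add: relu_def)
  qed
  moreover have "A j *\<^sub>v y x + b j \<in> carrier_vec (d (Suc j))" for x
    by (intro add_carrier_vec mult_mat_vec_carrier[OF A y(1)] b)
  ultimately show ?case by (simp add: y_def[symmetric] del: index_map_vec)
qed

lemma relu_mlp_piecewise_affine:
  assumes "is_real_relu_mlp m F"
    and z: "\<And>x. z x \<in> carrier_vec m" "\<And>i. i < m \<Longrightarrow> piecewise_affine (\<lambda>x. z x $ i)"
  shows "piecewise_affine (\<lambda>x. F (z x))"
proof -
  from assms(1) obtain J d A b where J: "1 \<le> J" and d: "d 0 = m" "d J = 1"
    and layers: "\<forall>j<J. A j \<in> carrier_mat (d (Suc j)) (d j) \<and> b j \<in> carrier_vec (d (Suc j))"
    and F: "\<forall>x\<in>carrier_vec m.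
      Matrix.vec 1 (\<lambda>_. F x) = A (J - 1) *\<^sub>v mlp_layer A b x (J - 1) + b (J - 1)"
    unfolding is_real_relu_mlp_def is_relu_mlp_def by (elim exE conjE) blast
  note hidden = mlp_layer_piecewise_affine[OF z[folded d(1)] layers, of "J - 1"]
  have "A (J - 1) \<in> carrier_mat 1 (d (J - 1))" "b (J - 1) \<in> carrier_vec 1"
    using layers J d by (auto dest!: spec[of _ "J - 1"])
  then have "piecewise_affine (\<lambda>x. (A (J - 1) *\<^sub>v mlp_layer A b (z x) (J - 1) + b (J - 1)) $ 0)"
    by (rule piecewise_affine_affine_layer) (use hidden in auto)
  moreover have "(A (J - 1) *\<^sub>v mlp_layer A b (z x) (J - 1) + b (J - 1)) $ 0 = F (z x)" for x
    using arg_cong[OF bspec[OF F z(1)[of x]], of "\<lambda>v. v $ 0"] by simp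
  ultimately show ?thesis by simp
qed

section \<open>Convex piecewise affine functions are maxima of affine functions\<close>

lemma interior_Union_finite_closed_empty:
  assumes "finite \<F>" "\<And>T. T \<in> \<F> \<Longrightarrow> closed T \<and> interior T = {}"
  shows "interior (\<Union>\<F>) = {}"
  using assms
proof (induction rule: finite_induct)
  case (insert T \<F>)
  then show ?case using interior_closed_Un_empty_interior[of T "\<Union>\<F>"] by simp
qed simp

text \<open>
  Subtracting the affine function gives a convex function that vanishes near some point, so it
  has a local and hence a global minimum there.
\<close>

lemma convex_on_ge_affine_piece:
  assumes f: "convex_on UNIV (f :: 'h::real_inner \<Rightarrow> real)"
    and "interior {x. f x = inner v x + c} \<noteq> {}"
  shows "inner v y + c \<le> f y"
proof -
  obtain x0 e where e: "0 < e" "ball x0 e \<subseteq> {x. f x = inner v x + c}"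
    using assms(2) by (meson ex_in_conv mem_interior)
  define h where "h x = f x + (inner (- v) x - c)" for x
  have "convex_on UNIV (\<lambda>x. inner (- v) x - c)"
    using convex_lipschitz_inner[of "- v" "- c"] by (simp add: convex_lipschitz_def)
  then have "convex_on UNIV h" unfolding h_def by (intro convex_on_add f)
  moreover have h0: "h x = 0" if "x \<in> ball x0 e" for x
    using e(2) that by (auto simp: h_def)
  ultimately have "h x0 \<le> h y"
    using convex_local_global_minimum[of e UNIV h x0] e(1) by auto
  moreover have "h x0 = 0" using h0 e(1) by simp
  ultimately show ?thesis by (simp add: h_def)
qed

text \<open>
  The pieces that enter the maximum are those selected on a set with nonempty interior. The
  others need not be minorants, but the union of their coincidence sets has empty
  interior, so it contains no neighbourhood of a point.
\<close>

lemma convex_piecewise_affine_eq_Max: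
  fixes f :: "'h::real_inner \<Rightarrow> real"
  assumes "piecewise_affine f" and f: "convex_on UNIV f"
  shows "\<exists>T. finite T \<and> T \<noteq> {} \<and> (\<forall>x. f x = Max ((\<lambda>(v, c). inner v x + c) ` T))"
proof -
  from assms obtain S where cont: "continuous_on UNIV f"
    and S: "finite S" "\<And>x. \<exists>(v, c)\<in>S. f x = inner v x + c"
    unfolding piecewise_affine_def by auto
  define E where "E = (\<lambda>(v, c). {x. f x = inner v x + c})"
  define T where "T = {s \<in> S. interior (E s) \<noteq> {}}"
  have closed: "closed (E s)" for s
    unfolding E_def by (cases s) (auto intro!: closed_Collect_eq continuous_intros cont)
  have fin: "finite T" using S by (simp add: T_def)
  have "interior (\<Union>(E ` (S - T))) = {}"
    by (rule interior_Union_finite_closed_empty) (use S closed in \<open>auto simp: T_def\<close>)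
  moreover have "- \<Union>(E ` T) \<subseteq> \<Union>(E ` (S - T))"
    using S(2) by (fastforce simp: E_def)
  moreover have "open (- \<Union>(E ` T))"
    using fin closed by (intro open_Compl closed_UN) auto
  ultimately have "- \<Union>(E ` T) = {}" using interior_maximal by blast
  then have attained: "\<exists>s\<in>T. x \<in> E s" for x by auto
  have minorant: "inner v x + c \<le> f x" if "(v, c) \<in> T" for v c x
    using convex_on_ge_affine_piece[OF f] that by (auto simp: T_def E_def)
  have "f x = Max ((\<lambda>(v, c). inner v x + c) ` T)" for x
  proof (rule Max_eqI[symmetric])
    obtain v c where "(v, c) \<in> T" "f x = inner v x + c"
      using attained[of x] by (auto simp: E_def)
    then show "f x \<in> (\<lambda>(v, c). inner v x + c) ` T" by force
  qed (use fin minorant in auto)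
  moreover have "T \<noteq> {}" using attained by blast
  ultimately show ?thesis using fin by blast
qed

section \<open>Maxima of affine functions as convex neural functionals\<close>

text \<open>
  The network has one hidden layer. The affine functions are its input units; the hidden layer has
  identity weights and PReLU slopes \<open>1\<close>, which make the activation the identity, and pools all
  units into one.
\<close>

lemma is_cnf_Max_affine:
  fixes T :: "('h::{real_inner,complete_space} \<times> real) set"
  assumes T: "finite T" "T \<noteq> {}" and "(e::'h) \<noteq> 0"
  shows "is_cnf (\<lambda>x. Max ((\<lambda>(v, c). inner v x + c) ` T))"
proof -
  define K where "K = card T"
  have K: "1 \<le> K" using T by (simp add: K_def Suc_le_eq card_gt_0_iff)
  obtain g where g: "bij_betw g {..<K} T"
    using ex_bij_betw_nat_finite[OF T(1)] by (auto simp: K_def lessThan_atLeast0)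
  then have image_g: "g ` {..<K} = T" by (simp add: bij_betw_def)
  define p where "p m = fst (g m)" for m
  define q where "q m = snd (g m)" for m
  \<comment> \<open>The vector \<open>e\<close> makes the subspace nonzero even if all the affine functions are constant.\<close>
  define V where "V = span (insert e (fst ` T))"
  obtain B where B: "B \<subseteq> V" "independent B" "V \<subseteq> span B" "card B = dim V"
    using basis_exists by blast
  have finB: "finite B"
    using independent_span_bound[of "insert e (fst ` T)" B] B(1,2) T(1) by (simp add: V_def)
  have "B \<noteq> {}"
  proof
    assume "B = {}"
    then have "V \<subseteq> {0}" using B(3) by simp
    moreover have "e \<in> V" unfolding V_def by (simp add: span_base)
    ultimately show False using assms(3) by blast
  qed
  then have D: "1 \<le> card B" using finB by (simp add: Suc_le_eq card_gt_0_iff)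
  have pV: "p m \<in> V" if "m < K" for m
    unfolding V_def p_def using that image_g by (intro span_base) auto
  define d :: "nat \<Rightarrow> nat" where "d l = (if l = 0 then K else 1)" for l
  define d' :: "nat \<Rightarrow> nat" where "d' l = K" for l
  define A :: "nat \<Rightarrow> real mat" where "A l = (if l = 0 then 1\<^sub>m K else 1\<^sub>m 1)" for l
  define b :: "nat \<Rightarrow> real vec" where "b l = (if l = 0 then 0\<^sub>v K else 0\<^sub>v 1)" for l
  define \<alpha> :: "nat \<Rightarrow> real vec" where "\<alpha> l = Matrix.vec K (\<lambda>_. 1)" for l
  define P :: "nat \<Rightarrow> nat \<Rightarrow> nat set" where "P l k = {..<K}" for l k
  have "0 \<in> {..<K}" using K by simp
  then have "{} \<noteq> {..<K}" by blast
  then have partition: "is_indexed_partition K 1 (P 0)"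
    by (auto simp: is_indexed_partition_def P_def partition_on_def disjoint_def intro: inj_onI)
  have \<Phi>: "Max ((\<lambda>(v, c). inner v x + c) ` T) =
     (A 1 *\<^sub>v cnf_layer d P \<alpha> A b (Matrix.vec K (\<lambda>m. inner (p m) x + q m)) 1 + b 1) $ 0" for x
  proof -
    let ?z = "Matrix.vec K (\<lambda>m. inner (p m) x + q m)"
    have z: "1\<^sub>m K *\<^sub>v ?z + 0\<^sub>v K = ?z" by simp
    have "prelu (\<alpha> 0) ?z = ?z"
      by (rule eq_vecI) (auto simp: prelu_def relu_def \<alpha>_def)
    then have "cnf_layer d P \<alpha> A b ?z 1 = Matrix.vec 1 (\<lambda>_. Max ((\<lambda>i. ?z $ i) ` {..<K}))"
      by (simp add: A_def b_def d_def P_def max_pool_def z)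
    moreover have "(\<lambda>i. ?z $ i) ` {..<K} = (\<lambda>(v, c). inner v x + c) ` T"
      unfolding image_g[symmetric] image_image
      by (rule image_cong) (auto simp: p_def q_def case_prod_beta)
    ultimately show ?thesis by (simp add: A_def b_def)
  qed
  show ?thesis
    unfolding is_cnf_def
  proof (rule exI[of _ "card B"], rule exI[of _ K], rule exI[of _ 2], rule exI[of _ V], rule exI[of _ p], rule exI[of _ q],
      rule exI[of _ d], rule exI[of _ d'], rule exI[of _ A], rule exI[of _ b],
      rule exI[of _ \<alpha>], rule exI[of _ P], intro conjI)
    show "\<exists>B' :: 'h set. finite B' \<and> independent B' \<and> card B' = card B"
      using finB B(2) by blast
    show "\<forall>m<K. p m \<in> V" using pV by blast
    show "\<forall>l<2-1.
           A l \<in> carrier_mat (d' (Suc l)) (d l) \<and> elements_mat (A l) \<subseteq> {0..} \<and>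
           b l \<in> carrier_vec (d' (Suc l)) \<and>
           \<alpha> l \<in> carrier_vec (d' (Suc l)) \<and> set\<^sub>v (\<alpha> l) \<subseteq> {0..1} \<and>
           is_indexed_partition (d' (Suc l)) (d (Suc l)) (P l)"
      using partition
      by (auto simp: A_def b_def \<alpha>_def d_def d'_def vec_set_def elements_mat_def)
    show "\<forall>x. Max ((\<lambda>(v, c). inner v x + c) ` T) =
      (A (2-1) *\<^sub>v cnf_layer d P \<alpha> A b (Matrix.vec K (\<lambda>m. inner (p m) x + q m)) (2-1) + b (2-1)) $ 0"
      using \<Phi> by simp
  qed (use K D B(4) in \<open>auto simp: V_def d_def d'_def A_def b_def elements_mat_def\<close>)
qed

section \<open>Composing a convex network with an affine map\<close>

lemma convex_on_comp_affine:
  assumes "convex_on_carrier M F"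
  shows "convex_on UNIV (\<lambda>x. F (Matrix.vec M (\<lambda>m. inner (p m) x + q m)))"
proof (rule convex_onI)
  fix t :: real and x y assume t: "0 < t" "t < 1"
  let ?z = "\<lambda>x. Matrix.vec M (\<lambda>m. inner (p m) x + q m)"
  have "?z ((1 - t) *\<^sub>R x + t *\<^sub>R y) = (1 - t) \<cdot>\<^sub>v ?z x + t \<cdot>\<^sub>v ?z y"
    by (rule eq_vecI) (auto simp: algebra_simps)
  then show "F (?z ((1 - t) *\<^sub>R x + t *\<^sub>R y)) \<le> (1 - t) * F (?z x) + t * F (?z y)"
    using assms t by (auto simp: convex_on_carrier_def)
qed simp

lemma convex_mlp_comp_affine_is_cnf:
  fixes p :: "nat \<Rightarrow> 'h::{real_inner,complete_space}"
  assumes "is_real_relu_mlp M F" "convex_on_carrier M F" "(e::'h) \<noteq> 0"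
  shows "is_cnf (\<lambda>x. F (Matrix.vec M (\<lambda>m. inner (p m) x + q m)))" (is "is_cnf ?f")
proof -
  have "piecewise_affine ?f"
    by (rule relu_mlp_piecewise_affine[OF assms(1)]) (auto simp: piecewise_affine_inner)
  from convex_piecewise_affine_eq_Max[OF this convex_on_comp_affine[OF assms(2)]]
  obtain T where T: "finite T" "T \<noteq> {}" and f: "\<forall>x. ?f x = Max ((\<lambda>(v, c). inner v x + c) ` T)"
    by (elim exE conjE)
  have "?f = (\<lambda>x. Max ((\<lambda>(v, c). inner v x + c) ` T))"
    by (rule ext) (rule f[rule_format])
  then show ?thesis by (rule ssubst) (rule is_cnf_Max_affine[OF T assms(3)])
qed

theorem theorem3p3:
  shows
    "(\<forall>\<Phi> :: 'h::{real_inner,complete_space} \<Rightarrow> real.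
        is_cnf \<Phi> \<longrightarrow> convex_on UNIV \<Phi> \<and> (\<exists>K. K-lipschitz_on UNIV \<Phi>)) \<and>
     (\<forall>(L\<^sub>0::real) (C :: 'h set) (\<rho> :: 'h \<Rightarrow> real) (N::nat) (\<xi> :: nat \<Rightarrow> 'h) (y :: nat \<Rightarrow> real)
        (\<epsilon>::real) (M::nat) (p :: nat \<Rightarrow> 'h) (\<Phi>\<^sub>M :: real vec \<Rightarrow> real) (\<Psi>\<^sub>N :: real vec \<Rightarrow> real)
        (f :: 'h \<Rightarrow> real).
        0 < L\<^sub>0 \<and>
        (\<exists>x::'h. x \<noteq> 0) \<and> separable_space (euclidean :: 'h topology) \<and>
        compact C \<and> convex C \<and> 0 < diameter C \<and>
        convex_on C \<rho> \<and> L\<^sub>0-lipschitz_on C \<rho> \<and>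
        1 \<le> N \<and> (\<forall>n<N. \<xi> n \<in> C \<and> y n = \<rho> (\<xi> n)) \<and>
        0 < \<epsilon> \<and>
        1 \<le> M \<and> (\<forall>m<M. p m \<in> cball 0 L\<^sub>0) \<and>
        is_real_relu_mlp M \<Phi>\<^sub>M \<and> convex_on_carrier M \<Phi>\<^sub>M \<and>
        is_real_relu_mlp N \<Psi>\<^sub>N \<and> concave_on_carrier N \<Psi>\<^sub>N \<and>
        f = (\<lambda>x. \<Phi>\<^sub>M (Matrix.vec M (\<lambda>m.
               inner (p m) x + \<Psi>\<^sub>N (Matrix.vec N (\<lambda>n. y n - inner (p m) (\<xi> n)))))) \<and>
        Max ((\<lambda>n. \<bar>\<rho> (\<xi> n) - f (\<xi> n)\<bar>) ` {..<N}) < \<epsilon>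
        \<longrightarrow> (\<exists>\<Phi> :: 'h \<Rightarrow> real. is_cnf \<Phi> \<and> (\<forall>x. \<Phi> x = f x)))"
proof (intro conjI allI impI)
  fix \<Phi> :: "'h \<Rightarrow> real"
  assume "is_cnf \<Phi>"
  then show "convex_on UNIV \<Phi>" "\<exists>K. K-lipschitz_on UNIV \<Phi>"
    using is_cnf_convex_lipschitz by (auto simp: convex_lipschitz_def)
next
  fix L\<^sub>0 C \<rho> N \<xi> y \<epsilon> M and p :: "nat \<Rightarrow> 'h" and \<Phi>\<^sub>M \<Psi>\<^sub>N f
  assume asms: "0 < L\<^sub>0 \<and>
        (\<exists>x::'h. x \<noteq> 0) \<and> separable_space (euclidean :: 'h topology) \<and>
        compact C \<and> convex C \<and> 0 < diameter C \<and>
        convex_on C \<rho> \<and> L\<^sub>0-lipschitz_on C \<rho> \<and>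
        1 \<le> N \<and> (\<forall>n<N. \<xi> n \<in> C \<and> y n = \<rho> (\<xi> n)) \<and>
        0 < \<epsilon> \<and>
        1 \<le> M \<and> (\<forall>m<M. p m \<in> cball 0 L\<^sub>0) \<and>
        is_real_relu_mlp M \<Phi>\<^sub>M \<and> convex_on_carrier M \<Phi>\<^sub>M \<and>
        is_real_relu_mlp N \<Psi>\<^sub>N \<and> concave_on_carrier N \<Psi>\<^sub>N \<and>
        f = (\<lambda>x. \<Phi>\<^sub>M (Matrix.vec M (\<lambda>m.
               inner (p m) x + \<Psi>\<^sub>N (Matrix.vec N (\<lambda>n. y n - inner (p m) (\<xi> n)))))) \<and>
        Max ((\<lambda>n. \<bar>\<rho> (\<xi> n) - f (\<xi> n)\<bar>) ` {..<N}) < \<epsilon>"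
  then have "\<exists>e::'h. e \<noteq> 0" by (elim conjE)
  then obtain e :: 'h where "e \<noteq> 0" by blast
  moreover from asms have "is_real_relu_mlp M \<Phi>\<^sub>M" "convex_on_carrier M \<Phi>\<^sub>M"
    and f: "f = (\<lambda>x. \<Phi>\<^sub>M (Matrix.vec M (\<lambda>m.
      inner (p m) x + \<Psi>\<^sub>N (Matrix.vec N (\<lambda>n. y n - inner (p m) (\<xi> n))))))"
    by - (elim conjE, assumption)+
  ultimately have "is_cnf f"
    unfolding f by (intro convex_mlp_comp_affine_is_cnf)
  then show "\<exists>\<Phi> :: 'h \<Rightarrow> real. is_cnf \<Phi> \<and> (\<forall>x. \<Phi> x = f x)" by blast
qed

end
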